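(* Define rationals by $$\rho_0=1,\qquad \rho_n=\sum_{k=0}^{n-1}\rho_k\,\frac{2\,(-1)^{n-1-k}}{(n-k+1)(n-k+2)}\quad(n\ge 1),$$ $$s_n=1+2\sum_{k=1}^{n}(-1)^k\rho_k,\qquad t_n=\sum_{k=0}^{n}(-1)^k\binom{n}{k}s_k\quad(n\ge 0),$$ and $a_0=1$, $a_n=\dfrac{1}{t_n}-\dfrac{1}{t_{n-1}}$ for $n\ge 1$. Then $(a_n)$ is not a Hausdorff moment sequence on $[0,1]$: $$\sum_{j=0}^{7}(-1)^j\binom{7}{j}a_j=-\frac{28629387882812}{1395498975394445}<0.$$
   Context: A sequence $(a_n)_{n\ge 0}$ is a Hausdorff moment sequence on $[0,1]$ if there is a finite positive Borel measure $\rho$ on $[0,1]$ with $a_n=\int_{[0,1]}s^n\,d\rho(s)$ for all $n\ge 0$. *)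

theory Defs
  imports "HOL-Analysis.Analysis"
begin

definition hausdorff_moment_seq :: "(nat \<Rightarrow> real) \<Rightarrow> bool" where
  "hausdorff_moment_seq a \<longleftrightarrow>
     (\<exists>M :: real measure. sets M = sets (restrict_space borel {0..1}) \<and> finite_measure M \<and>
        (\<forall>n. a n = (\<integral>s. s ^ n \<partial>M)))"

text \<open>The natural-number subtractions below are exact, since \<open>k < n\<close>.\<close>

fun rho :: "nat \<Rightarrow> rat" where
  "rho n = (if n = 0 then 1
     else (\<Sum>k<n. rho k * (2 * (- 1) ^ (n - 1 - k) /
             (of_nat (n - k + 1) * of_nat (n - k + 2)))))"

declare rho.simps [simp del]

definition s_seq :: "nat \<Rightarrow> rat" where
  "s_seq n = 1 + 2 * (\<Sum>k = 1..n. (- 1) ^ k * rho k)"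

definition t_seq :: "nat \<Rightarrow> rat" where
  "t_seq n = (\<Sum>k = 0..n. (- 1) ^ k * of_nat (n choose k) * s_seq k)"

definition a_seq :: "nat \<Rightarrow> rat" where
  "a_seq n = (if n = 0 then 1 else 1 / t_seq n - 1 / t_seq (n - 1))"

end

theory Submission
  imports Defs
begin

text \<open>
  For a measure \<open>M\<close> on \<open>[0,1]\<close> with moments \<open>a\<^sub>j\<close>, the binomial theorem under the integral turns the
  alternating sum \<open>\<Sum>j\<le>n. (-1)^j * (n choose j) * a\<^sub>j\<close> into \<open>\<integral>(1 - s)^n dM(s)\<close>, and this is nonnegative
  because the integrand is (\<open>hausdorff_moment_seq_alternating_sum_nonneg\<close>). This is the easy half of
  Hausdorff's characterisation of moment sequences by complete monotonicity. One negative
  alternating difference therefore refutes the moment property.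

  For the present sequence \<open>n = 7\<close> is the first order at which the sign fails. As the recursion is over
  the rationals, the difference is found by exact evaluation of
  \<open>\<rho>\<close>, \<open>s\<close>, \<open>t\<close> and \<open>a\<close> up to index 7 (\<open>alternating_sum_a_seq_7\<close>).
\<close>

section \<open>Alternating differences of moment sequences\<close>

text \<open>
  Integrating termwise is legitimate because the powers are bounded on \<open>[0,1]\<close> and \<open>M\<close> is finite; the
  hypothesis that \<open>M\<close> lives on \<open>[0,1]\<close> enters a second time as the sign of \<open>(1 - s)^n\<close>, which for odd
  \<open>n\<close> would fail beyond \<open>1\<close>.
\<close>

lemma hausdorff_moment_seq_alternating_sum_nonneg:
  assumes "hausdorff_moment_seq a"
  shows "0 \<le> (\<Sum>j = 0..n. (- 1) ^ j * of_nat (n choose j) * a j)"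
proof -
  obtain M :: "real measure" where sets_M: "sets M = sets (restrict_space borel {0..1})"
    and fin: "finite_measure M" and moments: "\<And>k. a k = (\<integral>s. s ^ k \<partial>M)"
    using assms unfolding hausdorff_moment_seq_def by blast
  interpret finite_measure M by (fact fin)
  have space_M: "space M = {0..1}"
    using sets_eq_imp_space_eq[OF sets_M] by (simp add: space_restrict_space)
  have meas: "(\<lambda>s. s ^ k) \<in> borel_measurable M" for k :: nat
  proof -
    have "(\<lambda>s::real. s ^ k) \<in> borel_measurable (restrict_space borel {0..1})"
      by (intro measurable_restrict_space1) measurable
    then show ?thesis
      using measurable_cong_sets[OF sets_M refl] by blast
  qed
  have integrable_power: "integrable M (\<lambda>s. s ^ k)" for k :: nat
    by (rule integrable_const_bound[where B = 1])
      (auto simp: space_M power_le_one abs_le_iff intro!: AE_I2 meas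
        order_trans[OF _ zero_le_power])
  have "(\<Sum>j = 0..n. (- 1) ^ j * of_nat (n choose j) * a j)
      = (\<integral>s. (\<Sum>j = 0..n. (- 1) ^ j * of_nat (n choose j) * s ^ j) \<partial>M)"
    by (simp add: moments integrable_power)
  also have "\<dots> = (\<integral>s. (1 - s) ^ n \<partial>M)"
  proof -
    have "(\<Sum>j = 0..n. (- 1) ^ j * of_nat (n choose j) * s ^ j) = (1 - s) ^ n" for s :: real
      using binomial_ring[of "- s" 1 n]
      by (simp add: atMost_atLeast0 power_minus[of s] mult_ac)
    then show ?thesis by simp
  qed
  also have "\<dots> \<ge> 0"
    by (rule integral_nonneg_AE) (auto simp: space_M intro!: AE_I2)
  finally show ?thesis .
qed

section \<open>Exact evaluation up to index 7\<close>

text \<open>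
  Peels off the last summand while the bound stays a numeral, so that tabulated values at numeral
  arguments rewrite the summands.
\<close>

lemma sum_atLeastAtMost_numeral:
  fixes f :: "nat \<Rightarrow> 'a::comm_monoid_add"
  assumes "m \<le> numeral k"
  shows "sum f {m..numeral k} = sum f {m..pred_numeral k} + f (numeral k)"
  using assms by (simp add: numeral_eq_Suc sum.cl_ivl_Suc)

lemma binomial_numeral_numeral:
  "(numeral n choose numeral k)
    = (pred_numeral n choose pred_numeral k) + (pred_numeral n choose numeral k)"
  by (simp add: numeral_eq_Suc)

text \<open>
  The argument \<open>1\<close> is written \<open>Suc 0\<close>, the form in which the simplifier meets it in the later sums.
\<close>

lemma rho_values:
  shows "rho 0 = 1"
    and "rho (Suc 0) = 1 / 3"
    and "rho 2 = - (1 / 18)"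
    and "rho 3 = 7 / 270"
    and "rho 4 = - (5 / 324)"
    and "rho 5 = 353 / 34020"
    and "rho 6 = - (7669 / 1020600)"
    and "rho 7 = 17519 / 3061800"
proof -
  show r0: "rho 0 = 1"
    by (subst rho.simps) simp
  show r1: "rho (Suc 0) = 1 / 3"
    by (subst rho.simps) (simp add: lessThan_nat_numeral lessThan_Suc r0)
  show r2: "rho 2 = - (1 / 18)"
    by (subst rho.simps) (simp add: lessThan_nat_numeral lessThan_Suc r0 r1)
  show r3: "rho 3 = 7 / 270"
    by (subst rho.simps) (simp add: lessThan_nat_numeral lessThan_Suc r0 r1 r2)
  show r4: "rho 4 = - (5 / 324)"
    by (subst rho.simps) (simp add: lessThan_nat_numeral lessThan_Suc r0 r1 r2 r3)
  show r5: "rho 5 = 353 / 34020"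
    by (subst rho.simps) (simp add: lessThan_nat_numeral lessThan_Suc r0 r1 r2 r3 r4)
  show r6: "rho 6 = - (7669 / 1020600)"
    by (subst rho.simps) (simp add: lessThan_nat_numeral lessThan_Suc r0 r1 r2 r3 r4 r5)
  show r7: "rho 7 = 17519 / 3061800"
    by (subst rho.simps) (simp add: lessThan_nat_numeral lessThan_Suc r0 r1 r2 r3 r4 r5 r6)
qed

lemma s_seq_values:
  shows "s_seq 0 = 1"
    and "s_seq (Suc 0) = 1 / 3"
    and "s_seq 2 = 2 / 9"
    and "s_seq 3 = 23 / 135"
    and "s_seq 4 = 113 / 810"
    and "s_seq 5 = 202 / 1701"
    and "s_seq 6 = 52931 / 510300"
    and "s_seq 7 = 10091 / 109350"
  by (simp_all add: s_seq_def sum_atLeastAtMost_numeral rho_values)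

lemma t_seq_values:
  shows "t_seq 0 = 1"
    and "t_seq (Suc 0) = 2 / 3"
    and "t_seq 2 = 5 / 9"
    and "t_seq 3 = 67 / 135"
    and "t_seq 4 = 371 / 810"
    and "t_seq 5 = 1465 / 3402"
    and "t_seq 6 = 209081 / 510300"
    and "t_seq 7 = 85961 / 218700"
  by (simp_all add: t_seq_def sum_atLeastAtMost_numeral s_seq_values
      binomial_numeral_numeral binomial_eq_0)

lemma a_seq_values:
  shows "a_seq 0 = 1"
    and "a_seq (Suc 0) = 1 / 2"
    and "a_seq 2 = 3 / 10"
    and "a_seq 3 = 72 / 335"
    and "a_seq 4 = 4185 / 24857"
    and "a_seq 5 = 75492 / 543515"
    and "a_seq 6 = 36295938 / 306303665"
    and "a_seq 7 = 1860116400 / 17972811841"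
  by (simp_all add: a_seq_def t_seq_values)

lemma alternating_sum_a_seq_7:
  "(\<Sum>j = 0..7. (- 1) ^ j * of_nat (7 choose j) * a_seq j)
    = - (28629387882812 / 1395498975394445)"
  by (simp add: sum_atLeastAtMost_numeral a_seq_values
      binomial_numeral_numeral binomial_eq_0)

theorem mainTheorem14:
  shows "\<not> hausdorff_moment_seq (\<lambda>n. real_of_rat (a_seq n)) \<and>
    (\<Sum>j = 0..7. (- 1) ^ j * of_nat (7 choose j) * a_seq j)
      = - (28629387882812 / 1395498975394445) \<and>
    - (28629387882812 / 1395498975394445 :: rat) < 0"
proof -
  have neg: "- (28629387882812 / 1395498975394445 :: rat) < 0" by simp
  have "\<not> hausdorff_moment_seq (\<lambda>n. real_of_rat (a_seq n))"
  proof
    assume "hausdorff_moment_seq (\<lambda>n. real_of_rat (a_seq n))"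
    then have "0 \<le> (\<Sum>j = 0..7. (- 1) ^ j * of_nat (7 choose j) * real_of_rat (a_seq j))"
      by (rule hausdorff_moment_seq_alternating_sum_nonneg)
    also have "\<dots> = real_of_rat (\<Sum>j = 0..7. (- 1) ^ j * of_nat (7 choose j) * a_seq j)"
      by (simp add: of_rat_sum of_rat_mult of_rat_power of_rat_minus)
    also have "\<dots> < 0"
      unfolding alternating_sum_a_seq_7 using neg by (simp only: of_rat_less_0_iff)
    finally show False by simp
  qed
  with alternating_sum_a_seq_7 neg show ?thesis by blast
qed

end
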